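(* For every real $\gamma>0$ the following holds for all sufficiently large integers $n$. If $H$ is a $3$-graph on $n$ vertices which is induced $K_4^-$-free and satisfies $\delta_2(H)\ge (1/8+\gamma)n$, then $H$ contains a $Y$-tiling that covers all but at most $40/\gamma+1$ vertices of $H$.
   Context: A $3$-graph $H$ has edge set a family of $3$-element subsets of $V(H)$. $K_4^-$ is the unique (up to isomorphism) $3$-graph with $4$ vertices and $3$ edges; $Y$ is the unique (up to isomorphism) $3$-graph with $4$ vertices and $2$ edges. $H$ is induced $K_4^-$-free if there is no $4$-set $W\subseteq V(H)$ such that exactly $3$ of the $3$-subsets of $W$ are edges of $H$. For distinct vertices $x,y$, $\deg_H(\{x,y\})$ is the number of vertices $z$ with $\{x,y,z\}\in E(H)$, and $\delta_2(H)$ is the minimum of this over all pairs. A $Y$-tiling in $H$ is a collection of vertex-disjoint copies of $Y$ that are subgraphs of $H$; it covers the union of their vertex sets. *)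

theory Defs
  imports Complex_Main
begin

type_synonym 'a hypergraph = "'a set \<times> 'a set set"

abbreviation verts :: "'a hypergraph \<Rightarrow> 'a set" where
  "verts H \<equiv> fst H"

abbreviation edges :: "'a hypergraph \<Rightarrow> 'a set set" where
  "edges H \<equiv> snd H"

definition three_graph :: "'a hypergraph \<Rightarrow> bool" where
  "three_graph H \<longleftrightarrow> finite (verts H) \<and> (\<forall>e\<in>edges H. e \<subseteq> verts H \<and> card e = 3)"

definition subhypergraph :: "'a hypergraph \<Rightarrow> 'a hypergraph \<Rightarrow> bool" where
  "subhypergraph K H \<longleftrightarrow> verts K \<subseteq> verts H \<and> edges K \<subseteq> edges H"

definition induced_K4_minus_free :: "'a hypergraph \<Rightarrow> bool" where
  "induced_K4_minus_free H \<longleftrightarrow>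
     \<not> (\<exists>W. W \<subseteq> verts H \<and> card W = 4 \<and> card {e \<in> edges H. e \<subseteq> W} = 3)"

(* In a 3-graph, {x, y, z} being an edge forces z to differ from x and y. *)
definition codegree :: "'a hypergraph \<Rightarrow> 'a \<Rightarrow> 'a \<Rightarrow> nat" where
  "codegree H x y = card {z \<in> verts H. {x, y, z} \<in> edges H}"

(* Min is unspecified on the empty set, so this is only meaningful for at least two vertices. *)
definition min_codegree :: "'a hypergraph \<Rightarrow> nat" where
  "min_codegree H = Min {codegree H x y | x y. x \<in> verts H \<and> y \<in> verts H \<and> x \<noteq> y}"

(* All 3-graphs with 4 vertices and 2 edges are isomorphic, so these counts say that K is a copy of Y. *)
definition is_Y :: "'a hypergraph \<Rightarrow> bool" where
  "is_Y K \<longleftrightarrow> three_graph K \<and> card (verts K) = 4 \<and> card (edges K) = 2"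

definition Y_tiling :: "'a hypergraph \<Rightarrow> 'a hypergraph set \<Rightarrow> bool" where
  "Y_tiling H T \<longleftrightarrow>
     (\<forall>K\<in>T. is_Y K \<and> subhypergraph K H) \<and>
     pairwise (\<lambda>K L. disjnt (verts K) (verts L)) T"

definition covered :: "'a hypergraph set \<Rightarrow> 'a set" where
  "covered T = (\<Union>K\<in>T. verts K)"

end

theory Submission
  imports Defs "HOL-Analysis.Convex"
begin

text \<open>
  Let \<open>T\<close> be a maximum tiling and \<open>U\<close> the set of uncovered vertices, with \<open>u\<close> elements. As \<open>U\<close> spans
  no \<open>Y\<close>, a pair in \<open>U\<close> has at most one neighbour in \<open>U\<close>. For a covered vertex \<open>w\<close> consider the link
  graph of \<open>w\<close> on \<open>U\<close>. A triangle of that graph is an edge of \<open>H\<close>, because otherwise it would span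
  exactly three edges together with \<open>w\<close>; so two triangles sharing an edge would give a \<open>Y\<close> in \<open>U\<close>.
  As in Mantel's theorem the link graph therefore has at most \<open>u(u + 1)/4\<close> edges. If
  two vertices of the same tile had more than linearly many link edges, each of them would form a \<open>Y\<close>
  with a path of its link graph, and the tile could be exchanged for two. Hence a tile sends at most
  \<open>u\<^sup>2/4 + O(u)\<close> triples to pairs in \<open>U\<close>, whereas the codegree condition requires an average
  of about \<open>4(1/8 + \<gamma>)u\<^sup>2/2\<close>.
\<close>

section \<open>Graph counting for the link graphs\<close>

text \<open>Mantel's argument. For adjacent \<open>a\<close>, \<open>b\<close> inclusion-exclusion
  gives \<open>d a + d b \<le> card U + 1\<close>; summing over adjacent pairs and applying
  Cauchy-Schwarz bounds the degree sum \<open>F\<close>.\<close>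

lemma sum_degree_le_of_common_neighbours_le_1:
  fixes R :: "'a \<Rightarrow> 'a \<Rightarrow> bool"
  assumes fin: "finite U" and sym: "\<And>a b. R a b \<Longrightarrow> R b a"
    and common: "\<And>a b. a \<in> U \<Longrightarrow> b \<in> U \<Longrightarrow> R a b \<Longrightarrow> card {c \<in> U. R a c \<and> R b c} \<le> 1"
  shows "2 * (\<Sum>a\<in>U. card {b \<in> U. R a b}) \<le> card U * (card U + 1)"
proof -
  define d where "d a = card {b \<in> U. R a b}" for a
  define F where "F = sum d U"
  have deg_sum: "d a + d b \<le> card U + 1" if "a \<in> U" "b \<in> U" "R a b" for a b
  proof -
    have "d a + d b = card ({c \<in> U. R a c} \<union> {c \<in> U. R b c}) + card ({c \<in> U. R a c} \<inter> {c \<in> U. R b c})"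
      unfolding d_def by (rule card_Un_Int) (use fin in auto)
    also have "{c \<in> U. R a c} \<inter> {c \<in> U. R b c} = {c \<in> U. R a c \<and> R b c}" by auto
    also have "card ({c \<in> U. R a c} \<union> {c \<in> U. R b c}) \<le> card U"
      by (rule card_mono) (use fin in auto)
    finally show ?thesis using common[OF that] by linarith
  qed
  have left: "(\<Sum>a\<in>U. \<Sum>b | b \<in> U \<and> R a b. d a) = (\<Sum>a\<in>U. (d a)\<^sup>2)"
    by (simp add: d_def power2_eq_square)
  have "(\<Sum>a\<in>U. \<Sum>b | b \<in> U \<and> R a b. d b) = (\<Sum>b\<in>U. \<Sum>a | a \<in> U \<and> R a b. d b)"
    by (rule sum.swap_restrict) (use fin in auto)
  also have "\<dots> = (\<Sum>b\<in>U. \<Sum>a | a \<in> U \<and> R b a. d b)"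
    by (intro sum.cong) (use sym in auto)
  also note left
  finally have right: "(\<Sum>a\<in>U. \<Sum>b | b \<in> U \<and> R a b. d b) = (\<Sum>a\<in>U. (d a)\<^sup>2)" .
  \<comment> \<open>Over ordered adjacent pairs, each \<open>d a\<close> is counted
    \<open>d a\<close> times in either position.\<close>
  have "2 * (\<Sum>a\<in>U. (d a)\<^sup>2) = (\<Sum>a\<in>U. \<Sum>b | b \<in> U \<and> R a b. d a + d b)"
    by (simp add: sum.distrib left right del: sum_constant)
  also have "\<dots> \<le> (\<Sum>a\<in>U. \<Sum>b | b \<in> U \<and> R a b. card U + 1)"
    by (intro sum_mono) (use deg_sum in auto)
  also have "\<dots> = F * (card U + 1)"
    by (simp add: F_def d_def sum_distrib_right del: sum_constant mult_Suc_right) (simp add: mult.commute)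
  finally have upper: "2 * (\<Sum>a\<in>U. (d a)\<^sup>2) \<le> F * (card U + 1)" .
  have "(\<Sum>a\<in>U. real (d a))\<^sup>2 \<le> (\<Sum>a\<in>U. (real (d a))\<^sup>2) * card U"
    by (rule sum_squared_le_sum_of_squares)
  then have "real (F\<^sup>2) \<le> real ((\<Sum>a\<in>U. (d a)\<^sup>2) * card U)" by (simp add: F_def)
  then have "F\<^sup>2 \<le> (\<Sum>a\<in>U. (d a)\<^sup>2) * card U" by (simp only: of_nat_le_iff)
  then have "2 * F\<^sup>2 \<le> 2 * (\<Sum>a\<in>U. (d a)\<^sup>2) * card U" by simp
  also have "\<dots> \<le> F * (card U + 1) * card U" using upper by (rule mult_right_mono) simp
  finally have "F * (2 * F) \<le> F * (card U * (card U + 1))"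
    by (simp only: power2_eq_square mult_ac)
  then have "2 * F \<le> card U * (card U + 1)"
    unfolding mult_le_cancel1 by (cases "F = 0") simp_all
  then show ?thesis by (simp add: F_def d_def)
qed

text \<open>If every vertex outside \<open>X\<close> had at most one neighbour outside
  \<open>X\<close>, its degree would be at most \<open>card X + 1\<close>; allowing
  \<open>card U\<close> more for each vertex of \<open>X\<close>, the degree sum would be at most
  \<open>(2 * card X + 1) * card U\<close>.\<close>

lemma obtain_path_avoiding:
  fixes R :: "'a \<Rightarrow> 'a \<Rightarrow> bool"
  assumes "finite U" "finite X"
    and many: "(\<Sum>a\<in>U. card {b \<in> U. R a b}) > (2 * card X + 1) * card U"
  obtains a b c where "a \<in> U - X" "b \<in> U - X" "c \<in> U - X" "b \<noteq> c" "R a b" "R a c"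
proof -
  have "\<exists>a\<in>U - X. card {b \<in> U - X. R a b} \<ge> 2"
  proof (rule ccontr)
    assume "\<not> ?thesis"
    then have small: "card {b \<in> U - X. R a b} \<le> 1" if "a \<in> U - X" for a using that by force
    have "card {b \<in> U. R a b} \<le> (card X + 1) + (if a \<in> X then card U else 0)" if "a \<in> U" for a
    proof (cases "a \<in> X")
      case True
      then show ?thesis using card_mono[of U "{b \<in> U. R a b}"] assms(1) by auto
    next
      case False
      have "card {b \<in> U. R a b} \<le> card ({b \<in> U - X. R a b} \<union> X)"
        by (rule card_mono) (use assms(1,2) in auto)
      also have "\<dots> \<le> card {b \<in> U - X. R a b} + card X" by (rule card_Un_le)
      finally show ?thesis using small[of a] that False by simp
    qed
    then have "(\<Sum>a\<in>U. card {b \<in> U. R a b}) \<le> (\<Sum>a\<in>U. (card X + 1) + (if a \<in> X then card U else 0))"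
      by (rule sum_mono)
    also have "\<dots> = card U * (card X + 1) + card (U \<inter> X) * card U"
      unfolding sum.distrib using assms(1) by (simp add: sum.If_cases)
    also have "card (U \<inter> X) * card U \<le> card X * card U"
      by (intro mult_right_mono card_mono) (use assms(2) in auto)
    finally show False using many by (simp add: algebra_simps)
  qed
  then obtain a where a: "a \<in> U - X" and "\<not> card {b \<in> U - X. R a b} \<le> Suc 0" by force
  then obtain b c where "b \<in> U - X" "c \<in> U - X" "R a b" "R a c" "b \<noteq> c"
    using card_le_Suc0_iff_eq[of "{b \<in> U - X. R a b}"] assms(1) by auto
  with a show ?thesis using that by blast
qed

section \<open>Edges, copies of \<open>Y\<close> and four-sets in a 3-graph\<close>

lemma three_graph_edgeD:
  assumes "three_graph H" "{x, y, z} \<in> edges H"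
  shows "x \<noteq> y" "x \<noteq> z" "y \<noteq> z" "x \<in> verts H" "y \<in> verts H" "z \<in> verts H"
proof -
  have e: "{x, y, z} \<subseteq> verts H \<and> card {x, y, z} = 3"
    using assms unfolding three_graph_def by (elim conjE bspec)
  then have "card {x, y, z} = 3" ..
  then show "x \<noteq> y" "x \<noteq> z" "y \<noteq> z"
    by (auto simp: card_insert_if split: if_splits)
  show "x \<in> verts H" "y \<in> verts H" "z \<in> verts H" using e by simp_all
qed

text \<open>The copy keeps only the two given edges, so further edges of \<open>H\<close> on these
  vertices do no harm: tiles may be non-induced.\<close>

lemma obtain_Y:
  assumes H: "three_graph H" and e: "{a, b, c} \<in> edges H" "{a, b, d} \<in> edges H" and "c \<noteq> d"
  obtains K where "is_Y K" "subhypergraph K H" "verts K = {a, b, c, d}"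
proof
  note D = three_graph_edgeD[OF H e(1)] three_graph_edgeD[OF H e(2)] \<open>c \<noteq> d\<close>
  let ?K = "({a, b, c, d}, {{a, b, c}, {a, b, d}})"
  have "c \<notin> {a, b, d}" using D by simp
  then have "{a, b, c} \<noteq> {a, b, d}" by blast
  then show "is_Y ?K" using D by (auto simp: is_Y_def three_graph_def)
  show "subhypergraph ?K H" using D e by (auto simp: subhypergraph_def)
qed simp

text \<open>Turns a triangle in the link graph of \<open>w\<close> into an edge of \<open>H\<close>.
  This is where induced-freeness enters the counting.\<close>

lemma induced_K4_minus_freeD:
  assumes H: "three_graph H" and free: "induced_K4_minus_free H"
    and e: "{w, a, b} \<in> edges H" "{w, a, c} \<in> edges H" "{w, b, c} \<in> edges H"
  shows "{a, b, c} \<in> edges H"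
proof (rule ccontr)
  assume n: "{a, b, c} \<notin> edges H"
  define W where "W = {w, a, b, c}"
  note D = three_graph_edgeD[OF H e(1)] three_graph_edgeD[OF H e(2)] three_graph_edgeD[OF H e(3)]
  have W: "W \<subseteq> verts H" "card W = 4" "finite W" using D by (simp_all add: W_def)
  have minus: "W - {w} = {a, b, c}" "W - {a} = {w, b, c}" "W - {b} = {w, a, c}" "W - {c} = {w, a, b}"
    using D unfolding W_def by auto
  have "{f \<in> edges H. f \<subseteq> W} = {{w, a, b}, {w, a, c}, {w, b, c}}"
  proof (intro equalityI subsetI)
    fix f assume "f \<in> {f \<in> edges H. f \<subseteq> W}"
    then have f: "f \<in> edges H" "f \<subseteq> W" "card f = 3" using H by (auto simp: three_graph_def)
    \<comment> \<open>An edge inside \<open>W\<close> omits exactly one of the four vertices, which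
      leaves four candidates.\<close>
    have "card (W - f) = 1"
      using f W by (simp add: card_Diff_subset finite_subset)
    then obtain x where x: "W - f = {x}" by (rule card_1_singletonE)
    then have "f = W - {x}" "x \<in> W" using f(2) by blast+
    then have "f = {a, b, c} \<or> f = {w, b, c} \<or> f = {w, a, c} \<or> f = {w, a, b}"
      unfolding minus[symmetric] using W_def by blast
    then show "f \<in> {{w, a, b}, {w, a, c}, {w, b, c}}" using n f(1) by blast
  next
    fix f assume "f \<in> {{w, a, b}, {w, a, c}, {w, b, c}}"
    then show "f \<in> {f \<in> edges H. f \<subseteq> W}" using e unfolding W_def by blast
  qed
  moreover have "{w, a, b} \<noteq> {w, a, c}" "{w, a, b} \<noteq> {w, b, c}" "{w, a, c} \<noteq> {w, b, c}"
  proof -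
    have "b \<notin> {w, a, c}" "a \<notin> {w, b, c}" using D by simp_all
    then show "{w, a, b} \<noteq> {w, a, c}" "{w, a, b} \<noteq> {w, b, c}" "{w, a, c} \<noteq> {w, b, c}" by blast+
  qed
  ultimately have "card {f \<in> edges H. f \<subseteq> W} = 3" by simp
  then show False using W(1,2) free unfolding induced_K4_minus_free_def by blast
qed

lemma min_codegree_le:
  assumes "finite (verts H)" "x \<in> verts H" "y \<in> verts H" "x \<noteq> y"
  shows "min_codegree H \<le> codegree H x y"
proof -
  have "finite ((\<lambda>(x, y). codegree H x y) ` (verts H \<times> verts H))" using assms by simp
  then have "finite {codegree H x y | x y. x \<in> verts H \<and> y \<in> verts H \<and> x \<noteq> y}"
    by (rule rev_finite_subset) auto
  then show ?thesis unfolding min_codegree_def by (rule Min_le) (use assms in blast)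
qed

section \<open>Tilings: adding, removing and maximising\<close>

lemma Y_tiling_verts_subset: "Y_tiling H T \<Longrightarrow> covered T \<subseteq> verts H"
  by (auto simp: Y_tiling_def covered_def subhypergraph_def)

lemma finite_Y_tiling_set:
  assumes "three_graph H"
  shows "finite {K. is_Y K \<and> subhypergraph K H}"
proof (rule finite_subset)
  show "{K. is_Y K \<and> subhypergraph K H} \<subseteq> Pow (verts H) \<times> Pow (edges H)"
    by (auto simp: subhypergraph_def)
  have "edges H \<subseteq> Pow (verts H)" "finite (verts H)" using assms by (auto simp: three_graph_def)
  then show "finite (Pow (verts H) \<times> Pow (edges H))" by (auto intro: finite_subset)
qed

lemma Y_tiling_finite: "three_graph H \<Longrightarrow> Y_tiling H T \<Longrightarrow> finite T"
  by (rule finite_subset[OF _ finite_Y_tiling_set[of H]]) (auto simp: Y_tiling_def)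

text \<open>A tiling is a set, so \<open>K \<notin> T\<close> is what makes an insertion increase
  its size; it holds because a tile has vertices.\<close>

lemma Y_tiling_insert:
  assumes "Y_tiling H T" "is_Y K" "subhypergraph K H" "verts K \<inter> covered T = {}"
  shows "Y_tiling H (insert K T)" "K \<notin> T"
proof -
  have "disjnt (verts K) (verts L)" if "L \<in> T" for L
    using assms(4) that by (auto simp: covered_def disjnt_def)
  then show "Y_tiling H (insert K T)"
    using assms(1-3) by (simp add: Y_tiling_def pairwise_insert disjnt_sym)
  have "verts K \<noteq> {}" using assms(2) by (auto simp: is_Y_def)
  then show "K \<notin> T" using assms(4) by (auto simp: covered_def)
qed

lemma Y_tiling_remove:
  assumes "Y_tiling H T" "K \<in> T"
  shows "Y_tiling H (T - {K})" "covered (T - {K}) = covered T - verts K"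
proof -
  show "Y_tiling H (T - {K})"
    using assms(1) by (auto simp: Y_tiling_def pairwise_def)
  have "verts L \<inter> verts K = {}" if "L \<in> T - {K}" for L
    using assms that by (auto simp: Y_tiling_def pairwise_def disjnt_def)
  then show "covered (T - {K}) = covered T - verts K"
    using assms(2) unfolding covered_def by blast
qed

lemma obtain_maximum_Y_tiling:
  assumes "three_graph H"
  obtains T where "Y_tiling H T" "\<And>T'. Y_tiling H T' \<Longrightarrow> card T' \<le> card T"
proof -
  let ?S = "{K. is_Y K \<and> subhypergraph K H}"
  have "Y_tiling H {}" by (simp add: Y_tiling_def)
  \<comment> \<open>A tiling is a subset of the finite set \<open>?S\<close>, so sizes are bounded
    and a largest one exists.\<close>
  moreover have "card T' < Suc (card ?S)" if "Y_tiling H T'" for T'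
    using card_mono[OF finite_Y_tiling_set[OF assms], of T'] that
    by (auto simp: Y_tiling_def less_Suc_eq_le)
  ultimately have "\<exists>T. Y_tiling H T \<and> (\<forall>T'. Y_tiling H T' \<longrightarrow> card T' \<le> card T)"
    by (intro ex_has_greatest_nat[of "Y_tiling H" "{}" card]) auto
  then show ?thesis using that by blast
qed

section \<open>Structure around a maximum tiling\<close>

locale maximum_Y_tiling =
  fixes H :: "'a hypergraph" and T :: "'a hypergraph set"
  assumes H: "three_graph H" and free: "induced_K4_minus_free H"
    and tiling: "Y_tiling H T" and maximum: "\<And>T'. Y_tiling H T' \<Longrightarrow> card T' \<le> card T"
begin

definition U :: "'a set" where "U = verts H - covered T"

text \<open>Degree sum of the link graph of \<open>w\<close> on \<open>U\<close>, hence twice its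
  number of edges; counting ordered pairs avoids halves.\<close>

definition link_degree_sum :: "'a \<Rightarrow> nat" where
  "link_degree_sum w = (\<Sum>a\<in>U. card {b \<in> U. {w, a, b} \<in> edges H})"

lemma finite_verts: "finite (verts H)" using H by (simp add: three_graph_def)

lemma finite_U: "finite U" using finite_verts by (simp add: U_def)

text \<open>Otherwise the resulting \<open>Y\<close> could be added to \<open>T\<close>,
  contradicting maximality.\<close>

lemma no_Y_in_U:
  assumes "{a, b, c} \<in> edges H" "{a, b, d} \<in> edges H" "{a, b, c, d} \<subseteq> U"
  shows "c = d"
proof (rule ccontr)
  assume "c \<noteq> d"
  with obtain_Y[OF H assms(1,2)]
  obtain K where K: "is_Y K" "subhypergraph K H" "verts K = {a, b, c, d}" by blast
  have "verts K \<inter> covered T = {}" using K(3) assms(3) by (auto simp: U_def)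
  from Y_tiling_insert[OF tiling K(1,2) this] maximum[of "insert K T"]
  show False using Y_tiling_finite[OF H tiling] by simp
qed

lemma codegree_in_U_le_1:
  assumes "a \<in> U" "b \<in> U"
  shows "card {z \<in> U. {a, b, z} \<in> edges H} \<le> 1"
  unfolding One_nat_def using no_Y_in_U[of a b] assms finite_U by (subst card_le_Suc0_iff_eq) auto

lemma link_degree_sum_le: "2 * link_degree_sum w \<le> card U * (card U + 1)"
  unfolding link_degree_sum_def
proof (rule sum_degree_le_of_common_neighbours_le_1[OF finite_U])
  fix a b
  assume ab: "a \<in> U" "b \<in> U" "{w, a, b} \<in> edges H"
  \<comment> \<open>A common neighbour of adjacent \<open>a\<close>, \<open>b\<close> closes a
    triangle in the link graph, hence is a neighbour of the pair \<open>{a, b}\<close> in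
    \<open>H\<close>.\<close>
  have "{c \<in> U. {w, a, c} \<in> edges H \<and> {w, b, c} \<in> edges H} \<subseteq> {c \<in> U. {a, b, c} \<in> edges H}"
    using induced_K4_minus_freeD[OF H free ab(3)] by auto
  then have "card {c \<in> U. {w, a, c} \<in> edges H \<and> {w, b, c} \<in> edges H}
      \<le> card {c \<in> U. {a, b, c} \<in> edges H}"
    by (rule card_mono[rotated]) (simp add: finite_U)
  also have "\<dots> \<le> 1" by (rule codegree_in_U_le_1[OF ab(1,2)])
  finally show "card {c \<in> U. {w, a, c} \<in> edges H \<and> {w, b, c} \<in> edges H} \<le> 1" .
qed (simp add: insert_commute)

text \<open>A path in the link graph with centre \<open>a\<close> gives two edges sharing the pair
  \<open>{w, a}\<close>. The set \<open>X\<close> lets a second \<open>Y\<close> avoid the vertices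
  of a first.\<close>

lemma obtain_Y_from_link:
  assumes "finite X" and "link_degree_sum w > (2 * card X + 1) * card U"
  obtains K P where "is_Y K" "subhypergraph K H" "verts K = insert w P" "P \<subseteq> U - X" "card P = 3"
proof -
  obtain a b c where abc: "a \<in> U - X" "b \<in> U - X" "c \<in> U - X" "b \<noteq> c"
      "{w, a, b} \<in> edges H" "{w, a, c} \<in> edges H"
    using obtain_path_avoiding[OF finite_U assms(1), of "\<lambda>a b. {w, a, b} \<in> edges H"] assms(2)
    unfolding link_degree_sum_def by blast
  obtain K where "is_Y K" "subhypergraph K H" "verts K = {w, a, b, c}"
    using obtain_Y[OF H abc(5,6,4)] by blast
  moreover have "card {a, b, c} = 3"
    using three_graph_edgeD[OF H abc(5)] three_graph_edgeD[OF H abc(6)] abc(4) by simp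
  ultimately show ?thesis using abc(1-3) by (intro that[of K "{a, b, c}"]) auto
qed

text \<open>Exchange argument: replacing \<open>K\<close> by one \<open>Y\<close> through
  \<open>w\<close> and a disjoint one through \<open>w'\<close> would enlarge the tiling.\<close>

lemma not_two_rich_links:
  assumes K: "K \<in> T" and w: "w \<in> verts K" "w' \<in> verts K" "w \<noteq> w'"
    and rich: "link_degree_sum w > 7 * card U" "link_degree_sum w' > 7 * card U"
  shows False
proof -
  obtain L P where L: "is_Y L" "subhypergraph L H" "verts L = insert w P" "P \<subseteq> U - {}" "card P = 3"
    by (rule obtain_Y_from_link[of "{}" w]) (use rich in auto)
  have "finite P" using L(5) by (intro card_ge_0_finite) simp
  \<comment> \<open>The second path must avoid the three vertices of \<open>P\<close>, which is the
    source of \<open>7 = 2 * 3 + 1\<close>.\<close>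
  then obtain L' P' where L': "is_Y L'" "subhypergraph L' H" "verts L' = insert w' P'"
      "P' \<subseteq> U - P" "card P' = 3"
    by (rule obtain_Y_from_link[of P w']) (use rich L(5) in auto)
  have cov: "w \<in> covered T" "w' \<in> covered T" using K w by (auto simp: covered_def)
  note rem = Y_tiling_remove[OF tiling K]
  have "verts L \<inter> covered (T - {K}) = {}"
    using L(3,4) w(1) unfolding rem(2) by (auto simp: U_def)
  note ins = Y_tiling_insert[OF rem(1) L(1,2) this]
  have "covered (insert L (T - {K})) = verts L \<union> (covered T - verts K)"
    unfolding rem(2)[symmetric] by (simp add: covered_def)
  then have "verts L' \<inter> covered (insert L (T - {K})) = {}"
    using L(3,4) L'(3,4) w cov by (auto simp: U_def)
  note ins' = Y_tiling_insert[OF ins(1) L'(1,2) this]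
  have "finite T" by (rule Y_tiling_finite[OF H tiling])
  then have "card (insert L' (insert L (T - {K}))) = Suc (card T)"
    using ins(2) ins'(2) K card_Suc_Diff1[of T K] by simp
  then show False using maximum[OF ins'(1)] by simp
qed

text \<open>At most one vertex of the tile is rich and gets the Mantel bound; the other three
  contribute at most \<open>7 * card U\<close> each, and \<open>2 * 3 * 7 = 42\<close>.\<close>

lemma tile_link_degree_sum_le:
  assumes K: "K \<in> T"
  shows "2 * (\<Sum>w\<in>verts K. link_degree_sum w) \<le> card U * (card U + 1) + 42 * card U"
proof -
  have K4: "card (verts K) = 4" using tiling K by (auto simp: Y_tiling_def is_Y_def)
  then have fin: "finite (verts K)" by (intro card_ge_0_finite) simp
  \<comment> \<open>Take the rich vertex if there is one, and any vertex of the tile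
    otherwise.\<close>
  obtain w where w: "w \<in> verts K"
      and rest: "\<And>w'. w' \<in> verts K - {w} \<Longrightarrow> link_degree_sum w' \<le> 7 * card U"
  proof (cases "\<exists>w\<in>verts K. link_degree_sum w > 7 * card U")
    case True
    then show ?thesis using that not_two_rich_links[OF K] by (metis DiffE insertI1 not_le)
  next
    case False
    moreover have "verts K \<noteq> {}" using K4 by auto
    ultimately show ?thesis using that by (metis DiffD1 ex_in_conv not_le)
  qed
  have "(\<Sum>w'\<in>verts K - {w}. link_degree_sum w') \<le> of_nat (card (verts K - {w})) * (7 * card U)"
    by (rule sum_bounded_above) (rule rest)
  moreover have "card (verts K - {w}) = 3" using K4 w by simp
  moreover have "(\<Sum>w\<in>verts K. link_degree_sum w)
      = link_degree_sum w + (\<Sum>w'\<in>verts K - {w}. link_degree_sum w')"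
    by (rule sum.remove[OF fin w])
  ultimately show ?thesis using link_degree_sum_le[of w] by simp
qed

section \<open>Double counting edges with two uncovered vertices\<close>

lemma card_covered: "card (covered T) = 4 * card T"
proof -
  have "card (covered T) = (\<Sum>K\<in>T. card (verts K))"
    unfolding covered_def
  proof (rule card_UN_disjoint)
    show "finite T" by (rule Y_tiling_finite[OF H tiling])
    show "\<forall>K\<in>T. finite (verts K)" using tiling by (auto simp: Y_tiling_def is_Y_def three_graph_def)
    show "\<forall>K\<in>T. \<forall>L\<in>T. K \<noteq> L \<longrightarrow> verts K \<inter> verts L = {}"
      using tiling by (auto simp: Y_tiling_def pairwise_def disjnt_def)
  qed
  also have "\<dots> = (\<Sum>K\<in>T. 4)" using tiling by (intro sum.cong) (auto simp: Y_tiling_def is_Y_def)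
  finally show ?thesis by simp
qed

lemma card_verts: "card (verts H) = 4 * card T + card U"
  unfolding U_def card_covered[symmetric]
  using card_mono[OF finite_verts Y_tiling_verts_subset[OF tiling]]
    card_Diff_subset[OF _ Y_tiling_verts_subset[OF tiling]]
    finite_subset[OF Y_tiling_verts_subset[OF tiling] finite_verts]
  by simp

lemma sum_covered_le:
  "2 * (\<Sum>w\<in>covered T. link_degree_sum w) \<le> card T * (card U * (card U + 1) + 42 * card U)"
proof -
  have "(\<Sum>w\<in>covered T. link_degree_sum w) = (\<Sum>K\<in>T. \<Sum>w\<in>verts K. link_degree_sum w)"
    unfolding covered_def
  proof (rule sum.UNION_disjoint)
    show "finite T" by (rule Y_tiling_finite[OF H tiling])
    show "\<forall>K\<in>T. finite (verts K)" using tiling by (auto simp: Y_tiling_def is_Y_def three_graph_def)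
    show "\<forall>K\<in>T. \<forall>L\<in>T. K \<noteq> L \<longrightarrow> verts K \<inter> verts L = {}"
      using tiling by (auto simp: Y_tiling_def pairwise_def disjnt_def)
  qed
  then have "2 * (\<Sum>w\<in>covered T. link_degree_sum w)
      = (\<Sum>K\<in>T. 2 * (\<Sum>w\<in>verts K. link_degree_sum w))"
    by (simp add: sum_distrib_left)
  also have "\<dots> \<le> of_nat (card T) * (card U * (card U + 1) + 42 * card U)"
    by (rule sum_bounded_above) (rule tile_link_degree_sum_le)
  finally show ?thesis by simp
qed

text \<open>Counts triples \<open>(w, a, b)\<close> forming an edge, with \<open>w\<close> covered
  and \<open>a\<close>, \<open>b\<close> in \<open>U\<close>, first by the ordered pair and then by
  \<open>w\<close>.\<close>

lemma sum_covered_ge: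
  "card U * (card U - 1) * (min_codegree H - 1) \<le> (\<Sum>w\<in>covered T. link_degree_sum w)"
proof -
  have finC: "finite (covered T)"
    using Y_tiling_verts_subset[OF tiling] finite_verts by (rule finite_subset)
  \<comment> \<open>The pair loses at most one neighbour to \<open>U\<close>; all others are
    covered.\<close>
  have pair: "min_codegree H - 1 \<le> card {w \<in> covered T. {w, a, b} \<in> edges H}"
    if "a \<in> U" "b \<in> U - {a}" for a b
  proof -
    have "min_codegree H \<le> codegree H a b"
      by (rule min_codegree_le[OF finite_verts]) (use that in \<open>auto simp: U_def\<close>)
    also have "codegree H a b
        = card ({z \<in> U. {a, b, z} \<in> edges H} \<union> {w \<in> covered T. {w, a, b} \<in> edges H})"
      unfolding codegree_def using Y_tiling_verts_subset[OF tiling]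
      by (intro arg_cong[of _ _ card]) (auto simp: U_def insert_commute)
    also have "\<dots> \<le> card {z \<in> U. {a, b, z} \<in> edges H} + card {w \<in> covered T. {w, a, b} \<in> edges H}"
      by (rule card_Un_le)
    finally show ?thesis using codegree_in_U_le_1[of a b] that by simp
  qed
  have "card U * (card U - 1) * (min_codegree H - 1)
      = (\<Sum>a\<in>U. \<Sum>b\<in>U - {a}. min_codegree H - 1)"
    by (simp add: mult.assoc)
  also have "\<dots> \<le> (\<Sum>a\<in>U. \<Sum>b\<in>U - {a}. card {w \<in> covered T. {w, a, b} \<in> edges H})"
    by (intro sum_mono pair)
  also have "\<dots> \<le> (\<Sum>a\<in>U. \<Sum>b\<in>U. card {w \<in> covered T. {w, a, b} \<in> edges H})"
    by (intro sum_mono sum_mono2) (use finite_U in auto)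
  also have "\<dots> = (\<Sum>a\<in>U. \<Sum>b\<in>U. \<Sum>w | w \<in> covered T \<and> {w, a, b} \<in> edges H. 1)" by simp
  also have "\<dots> = (\<Sum>a\<in>U. \<Sum>w\<in>covered T. \<Sum>b | b \<in> U \<and> {w, a, b} \<in> edges H. 1)"
    by (intro sum.cong refl sum.swap_restrict finite_U finC)
  also have "\<dots> = (\<Sum>w\<in>covered T. \<Sum>a\<in>U. \<Sum>b | b \<in> U \<and> {w, a, b} \<in> edges H. 1)"
    by (rule sum.swap)
  also have "\<dots> = (\<Sum>w\<in>covered T. link_degree_sum w)" by (simp add: link_degree_sum_def)
  finally show ?thesis .
qed

section \<open>Comparing the two bounds\<close>

text \<open>With \<open>n = 4 * m + u\<close>, the codegree condition gives each tile a leading term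
  \<open>(1 + 8 * \<gamma>) * u * (u - 1)\<close>, against the upper bound
  \<open>u * (u + 43)\<close>. This fails once \<open>\<gamma> * (u - 1) > 40\<close>.\<close>

lemma card_U_le:
  fixes \<gamma> :: real
  assumes "\<gamma> > 0" and deg: "real (min_codegree H) \<ge> (1/8 + \<gamma>) * real (card (verts H))"
  shows "real (card U) \<le> 40 / \<gamma> + 1"
proof (rule ccontr)
  define u m where "u = real (card U)" and "m = real (card T)"
  assume "\<not> ?thesis"
  then have "u - 1 > 40 / \<gamma>" by (simp add: u_def)
  then have u\<gamma>: "\<gamma> * (u - 1) > 40" and "u > 1" using \<open>\<gamma> > 0\<close>
    by (simp add: field_simps, smt (verit) divide_pos_pos)
  \<comment> \<open>Two distinct uncovered vertices ensure that \<open>min_codegree H\<close> is a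
    genuine minimum.\<close>
  have "card U > 1" using \<open>u > 1\<close> by (simp add: u_def)
  then obtain a b where ab: "a \<in> U" "b \<in> U" "a \<noteq> b"
    using card_le_Suc0_iff_eq[OF finite_U] by auto
  \<comment> \<open>Codegrees are at most \<open>n\<close>, which forces \<open>\<gamma> < 1\<close>
    and hence \<open>u > 41\<close>; then the leftover term \<open>u / 8 - 1\<close> is
    positive.\<close>
  then have "min_codegree H \<le> codegree H a b"
    by (intro min_codegree_le[OF finite_verts]) (auto simp: U_def)
  also have "\<dots> \<le> card (verts H)"
    unfolding codegree_def by (rule card_mono[OF finite_verts]) auto
  finally have "(1/8 + \<gamma>) * real (card (verts H)) \<le> 1 * real (card (verts H))"
    using deg by simp
  moreover have "card (verts H) > 0" using ab finite_verts by (auto simp: U_def card_gt_0_iff)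
  ultimately have "\<gamma> < 1" by (simp only: mult_le_cancel_right) auto
  then have "\<gamma> * (u - 1) \<le> 1 * (u - 1)" using \<open>u > 1\<close> by (intro mult_right_mono) simp_all
  with u\<gamma> have "1 * (u - 1) > 40" by (rule less_le_trans)
  then have "u > 41" by simp
  \<comment> \<open>Expand \<open>(1/8 + \<gamma>) * (4 * m + u)\<close> and drop the positive term
    \<open>\<gamma> * u\<close>.\<close>
  have mindeg: "real (min_codegree H - 1) \<ge> (1/2 + 4 * \<gamma>) * m + (u / 8 - 1)"
  proof -
    have "(1/8 + \<gamma>) * real (card (verts H)) = (1/2 + 4 * \<gamma>) * m + u / 8 + \<gamma> * u"
      by (simp add: card_verts u_def m_def algebra_simps)
    moreover have "\<gamma> * u > 0" using \<open>\<gamma> > 0\<close> \<open>u > 41\<close> by simp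
    ultimately show ?thesis using deg by linarith
  qed
  have "u * (u - 1) * ((1/2 + 4 * \<gamma>) * m + (u / 8 - 1)) \<le> u * (u - 1) * real (min_codegree H - 1)"
    using mindeg \<open>u > 41\<close> by (intro mult_left_mono) auto
  also have "\<dots> = real (card U * (card U - 1) * (min_codegree H - 1))"
    using \<open>card U > 1\<close> by (simp add: u_def of_nat_diff)
  also have "\<dots> \<le> real (\<Sum>w\<in>covered T. link_degree_sum w)"
    using sum_covered_ge by (rule of_nat_mono)
  finally have "2 * (u * (u - 1) * ((1/2 + 4 * \<gamma>) * m + (u / 8 - 1)))
      \<le> real (2 * (\<Sum>w\<in>covered T. link_degree_sum w))"
    by simp
  also have "\<dots> \<le> real (card T * (card U * (card U + 1) + 42 * card U))"
    using sum_covered_le by (rule of_nat_mono)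
  also have "\<dots> = u * (m * (u + 43))" by (simp add: u_def m_def algebra_simps)
  finally have "u * (2 * (u - 1) * ((1/2 + 4 * \<gamma>) * m + (u / 8 - 1))) \<le> u * (m * (u + 43))"
    by (simp only: mult_ac)
  then have "2 * (u - 1) * ((1/2 + 4 * \<gamma>) * m + (u / 8 - 1)) \<le> m * (u + 43)"
    using \<open>u > 41\<close> by simp
  moreover have "2 * (u - 1) * ((1/2 + 4 * \<gamma>) * m + (u / 8 - 1))
      = m * (u - 1 + 8 * (\<gamma> * (u - 1))) + 2 * (u - 1) * (u / 8 - 1)"
    by (simp add: field_simps)
  \<comment> \<open>The gap between \<open>u + 43\<close> and \<open>u - 1\<close> is 44, whereas
    \<open>8 * (\<gamma> * (u - 1)) > 320\<close>.\<close>
  moreover have "m * (u + 43) \<le> m * (u - 1 + 8 * (\<gamma> * (u - 1)))"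
    using u\<gamma> by (intro mult_left_mono) (auto simp: m_def)
  moreover have "2 * (u - 1) * (u / 8 - 1) > 0" using \<open>u > 41\<close> by simp
  ultimately show False by linarith
qed

end

theorem theorem3p3:
  fixes \<gamma> :: real
  assumes "\<gamma> > 0"
  shows "\<exists>n\<^sub>0::nat. \<forall>n\<ge>n\<^sub>0. \<forall>H :: 'a hypergraph.
           three_graph H \<and> card (verts H) = n \<and> induced_K4_minus_free H \<and>
           real (min_codegree H) \<ge> (1/8 + \<gamma>) * real n \<longrightarrow>
           (\<exists>T. Y_tiling H T \<and> real (card (verts H - covered T)) \<le> 40 / \<gamma> + 1)"
\<comment> \<open>The bound \<open>card_U_le\<close> is uniform in \<open>n\<close>, so
  \<open>0\<close> serves as the threshold.\<close>
proof (intro exI[of _ 0] allI impI, elim conjE)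
  fix n :: nat and H :: "'a hypergraph"
  assume H: "three_graph H" "induced_K4_minus_free H" and n: "card (verts H) = n"
    and deg: "real (min_codegree H) \<ge> (1/8 + \<gamma>) * real n"
  obtain T where T: "Y_tiling H T" "\<And>T'. Y_tiling H T' \<Longrightarrow> card T' \<le> card T"
    using obtain_maximum_Y_tiling[OF H(1)] by blast
  interpret maximum_Y_tiling H T using H T by unfold_locales
  show "\<exists>T. Y_tiling H T \<and> real (card (verts H - covered T)) \<le> 40 / \<gamma> + 1"
    using T(1) card_U_le[OF assms] deg n by (auto simp: U_def)
qed

end
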